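(* Let $\Omega=[a,b]\times[c,d]$ and let $s_{kl}\in\mathcal{S}_{kl}^{\Delta\lambda,\Delta\mu}(\Omega)$, $s_{kl}(x,y)=\sum_{i=-k}^{g}\sum_{j=-l}^{h}b_{ij}B_i^{k+1}(x)B_j^{l+1}(y)$, be such that $\iint_\Omega s_{kl}(x,y)\,dx\,dy=0$. Let $s_k\in\mathcal{S}_k^{\Delta\lambda}[a,b]$ and $s_l\in\mathcal{S}_l^{\Delta\mu}[c,d]$ be defined as $s_k(x)=\int_c^d s_{kl}(x,y)\,dy$ and $s_l(y)=\int_a^b s_{kl}(x,y)\,dx$. Then $$s_k(x)=\sum_{i=-k}^{g}v_iB_i^{k+1}(x),\qquad s_l(y)=\sum_{j=-l}^{h}u_jB_j^{l+1}(y),$$ with $$v_i=\frac{b_{ih}}{t_h}+\cdots+\frac{b_{i,-l}}{t_{-l}},\quad t_{j'}=\frac{l+1}{\mu_{j'+l+1}-\mu_{j'}},\ j'=-l,\dots,h,$$ $$u_j=\frac{b_{gj}}{d_g}+\cdots+\frac{b_{-k,j}}{d_{-k}},\quad d_{j'}=\frac{k+1}{\lambda_{j'+k+1}-\lambda_{j'}},\ j'=-k,\dots,g.$$ Moreover, $\int_a^b s_k(x)\,dx=0$ and $\int_c^d s_l(y)\,dy=0$.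
   Context: Degrees $k,l>0$. Knots: $\Delta\lambda$: $\lambda_0=a<\lambda_1<\dots<\lambda_g<b=\lambda_{g+1}$; $\Delta\mu$: $\mu_0=c<\mu_1<\dots<\mu_h<d=\mu_{h+1}$; extended by coincident additional knots $\lambda_{-k}=\dots=\lambda_{-1}=a$, $\lambda_{g+2}=\dots=\lambda_{g+k+1}=b$, $\mu_{-l}=\dots=\mu_{-1}=c$, $\mu_{h+2}=\dots=\mu_{h+l+1}=d$. $B_i^{k+1}(x)$ ($i=-k,\dots,g$) denotes the normalized B-spline (partition of unity) of degree $k$ (order $k+1$) on the knots $\lambda_i,\dots,\lambda_{i+k+1}$; similarly $B_j^{l+1}(y)$ ($j=-l,\dots,h$) on $\mu_j,\dots,\mu_{j+l+1}$. $\mathcal{S}_k^{\Delta\lambda}[a,b]$ and $\mathcal{S}_l^{\Delta\mu}[c,d]$ are the spans of the $B_i^{k+1}$ and of the $B_j^{l+1}$, respectively; $\mathcal{S}_{kl}^{\Delta\lambda,\Delta\mu}(\Omega)$ is the space of tensor product splines $\sum_{i=-k}^{g}\sum_{j=-l}^{h}b_{ij}B_i^{k+1}(x)B_j^{l+1}(y)$, $b_{ij}\in\mathbb{R}$. *)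

theory Defs
  imports "HOL-Analysis.Analysis"
begin

definition extended_knots :: "nat \<Rightarrow> nat \<Rightarrow> real \<Rightarrow> real \<Rightarrow> (int \<Rightarrow> real) \<Rightarrow> bool" where
  "extended_knots k g a b \<tau> \<longleftrightarrow>
     \<tau> 0 = a \<and> \<tau> (int g + 1) = b \<and> strict_mono_on {0..int g + 1} \<tau> \<and>
     (\<forall>i\<in>{- int k..-1}. \<tau> i = a) \<and>
     (\<forall>i\<in>{int g + 2..int g + int k + 1}. \<tau> i = b)"

text \<open>
  Cox--de Boor recursion, indexed by the degree \<open>k\<close>, so that \<open>bspline \<tau> b k i\<close> is
  the B-spline of order \<open>k + 1\<close> on the knots \<open>\<tau> i, \<dots>, \<tau> (i + k + 1)\<close>. Terms with
  coincident knots are dropped, because division by zero yields zero. The nonempty degree 0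
  interval that ends at the right end point \<open>b\<close> is closed, all others are half open; without
  this, all B-splines would vanish at \<open>b\<close> and the partition of unity would fail there.
\<close>

fun bspline :: "(int \<Rightarrow> real) \<Rightarrow> real \<Rightarrow> nat \<Rightarrow> int \<Rightarrow> real \<Rightarrow> real" where
  "bspline \<tau> b 0 i x =
     (if \<tau> i \<le> x \<and> x < \<tau> (i + 1) \<or> \<tau> i < b \<and> \<tau> (i + 1) = b \<and> x = b then 1 else 0)"
| "bspline \<tau> b (Suc k) i x =
     (x - \<tau> i) / (\<tau> (i + int k + 1) - \<tau> i) * bspline \<tau> b k i x +
     (\<tau> (i + int k + 2) - x) / (\<tau> (i + int k + 2) - \<tau> (i + 1)) * bspline \<tau> b k (i + 1) x"

text \<open>Splines are functions on the rectangle or interval only; values outside it are irrelevant.\<close>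

definition spline_space :: "nat \<Rightarrow> nat \<Rightarrow> real \<Rightarrow> real \<Rightarrow> (int \<Rightarrow> real) \<Rightarrow> (real \<Rightarrow> real) set" where
  "spline_space k g a b \<tau> =
     {s. \<exists>coef. \<forall>x\<in>{a..b}. s x = (\<Sum>i = - int k..int g. coef i * bspline \<tau> b k i x)}"

definition tensor_spline_space ::
  "nat \<Rightarrow> nat \<Rightarrow> real \<Rightarrow> real \<Rightarrow> (int \<Rightarrow> real) \<Rightarrow>
   nat \<Rightarrow> nat \<Rightarrow> real \<Rightarrow> real \<Rightarrow> (int \<Rightarrow> real) \<Rightarrow> (real \<times> real \<Rightarrow> real) set" where
  "tensor_spline_space k g a b \<Lambda> l h c d \<mu> =
     {s. \<exists>coef. \<forall>x\<in>{a..b}. \<forall>y\<in>{c..d}. s (x, y) =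
        (\<Sum>i = - int k..int g. \<Sum>j = - int l..int h.
           coef i j * bspline \<Lambda> b k i x * bspline \<mu> d l j y)}"

end

theory Submission
  imports Defs
begin

text \<open>
  With \<open>h\<^sub>m\<close> the complete homogeneous symmetric polynomial, the moments of a B-spline are
  \<open>\<integral> x ^ m B\<^sub>i\<^sup>k\<^sup>+\<^sup>1(x) dx =
  (\<tau>\<^sub>i\<^sub>+\<^sub>k\<^sub>+\<^sub>1 - \<tau>\<^sub>i) k! m! / (m + k + 1)! h\<^sub>m(\<tau>\<^sub>i, \<dots>, \<tau>\<^sub>i\<^sub>+\<^sub>k\<^sub>+\<^sub>1)\<close>.
  Unlike the case \<open>m = 0\<close> alone, which is the one that matters here, this is stable under the
  Cox--de Boor recursion and so needs neither derivatives of B-splines nor additional knots.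
  The rest is Fubini's theorem for the finitely many products of two B-splines.
\<close>

section \<open>Complete homogeneous symmetric polynomials of consecutive knots\<close>

text \<open>The variables are the n + 1 knots from \<open>\<tau> i\<close> to
  \<open>\<tau> (i + n)\<close>. The recursion sorts the monomials by whether the last variable
  occurs in them.\<close>

fun complete_hom :: "(int \<Rightarrow> real) \<Rightarrow> int \<Rightarrow> nat \<Rightarrow> nat \<Rightarrow> real" where
  "complete_hom \<tau> i 0 m = \<tau> i ^ m"
| "complete_hom \<tau> i (Suc n) 0 = 1"
| "complete_hom \<tau> i (Suc n) (Suc m) =
     complete_hom \<tau> i n (Suc m) + \<tau> (i + int n + 1) * complete_hom \<tau> i (Suc n) m"

lemma complete_hom_0 [simp]: "complete_hom \<tau> i n 0 = 1"
  by (cases n) auto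

text \<open>By symmetry the first variable can be split off just like the last. As the definition
  only knows the last one, this takes a nested induction, on the number of variables and on the
  degree.\<close>

lemma complete_hom_Suc_left:
  "complete_hom \<tau> i (Suc n) (Suc m) =
     complete_hom \<tau> (i + 1) n (Suc m) + \<tau> i * complete_hom \<tau> i (Suc n) m"
proof (induction n arbitrary: m)
  case 0
  show ?case
  proof (induction m)
    case (Suc m)
    have "complete_hom \<tau> i (Suc 0) (Suc (Suc m)) =
        \<tau> i ^ Suc (Suc m) + \<tau> (i + 1) * complete_hom \<tau> i (Suc 0) (Suc m)"
      by simp
    also note Suc.IH
    finally show ?case by (simp add: algebra_simps)
  qed simp
next
  case IHn: (Suc n)
  show ?case
  proof (induction m)
    case 0
    show ?case using IHn[of 0] by (simp add: algebra_simps)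
  next
    case (Suc m)
    \<comment> \<open>After splitting off the last variable, each summand has either lower degree
      (\<open>Suc.IH\<close>) or fewer variables (\<open>IHn\<close>). Regrouping restores the last
      variable.\<close>
    have "complete_hom \<tau> i (Suc (Suc n)) (Suc (Suc m)) =
        complete_hom \<tau> i (Suc n) (Suc (Suc m)) +
        \<tau> (i + int (Suc n) + 1) * complete_hom \<tau> i (Suc (Suc n)) (Suc m)"
      by (rule complete_hom.simps)
    also note Suc.IH
    also note IHn
    finally show ?case by (simp add: algebra_simps)
  qed
qed

text \<open>Equate the expansions in the first and in the last variable. This is the recursion for
  divided differences of a monomial.\<close>

lemma complete_hom_difference:
  "(\<tau> (i + int n + 1) - \<tau> i) * complete_hom \<tau> i (Suc n) m =
     complete_hom \<tau> (i + 1) n (Suc m) - complete_hom \<tau> i n (Suc m)"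
  using complete_hom_Suc_left[of \<tau> i n m] by (simp add: algebra_simps)

text \<open>Solve both expansions for the polynomials in fewer variables; the terms containing the
  product of the two end knots cancel.\<close>

lemma complete_hom_ends:
  "\<tau> (i + int n + 1) * complete_hom \<tau> (i + 1) n m - \<tau> i * complete_hom \<tau> i n m =
     (\<tau> (i + int n + 1) - \<tau> i) * complete_hom \<tau> i (Suc n) m"
proof (cases m)
  case (Suc m')
  have "complete_hom \<tau> (i + 1) n m = complete_hom \<tau> i (Suc n) m - \<tau> i * complete_hom \<tau> i (Suc n) m'"
    using complete_hom_Suc_left[of \<tau> i n m'] Suc by simp
  moreover have "complete_hom \<tau> i n m =
      complete_hom \<tau> i (Suc n) m - \<tau> (i + int n + 1) * complete_hom \<tau> i (Suc n) m'"
    using Suc by simp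
  ultimately show ?thesis by (simp only:) (simp add: algebra_simps del: complete_hom.simps)
qed simp

text \<open>The binomial coefficient counts the monomials of degree m in n + 1 variables; the
  recursion turns into Pascal's rule.\<close>

lemma complete_hom_const:
  assumes "\<And>j. j \<in> {i..i + int n} \<Longrightarrow> \<tau> j = t"
  shows "complete_hom \<tau> i n m = real ((n + m) choose m) * t ^ m"
  using assms
proof (induction \<tau> i n m rule: complete_hom.induct)
  case (3 \<tau> i n m)
  then show ?case by (simp add: algebra_simps)
qed auto

section \<open>Normalized moments and their recursion in the degree\<close>

text \<open>The moment of order m without the factor \<open>\<tau> (i + k + 1) - \<tau> i\<close>,
  so that it stays meaningful when all knots coincide.\<close>

definition normalized_moment :: "(int \<Rightarrow> real) \<Rightarrow> nat \<Rightarrow> int \<Rightarrow> nat \<Rightarrow> real" where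
  "normalized_moment \<tau> k i m =
     fact k * fact m / fact (m + k + 1) * complete_hom \<tau> i (Suc k) m"

text \<open>
  For coincident knots the right-hand side is zero by the convention on division, and the left-hand
  side vanishes as well, so the dropped terms of the recursion need no special treatment.
\<close>

lemma normalized_moment_cancel:
  assumes "mono_on {i..i + int k + 1} \<tau>" and "t \<in> \<tau> ` {i..i + int k + 1}"
  defines "w \<equiv> \<tau> (i + int k + 1) - \<tau> i"
  shows "normalized_moment \<tau> k i (Suc m) - t * normalized_moment \<tau> k i m =
           1 / w * (w * normalized_moment \<tau> k i (Suc m)) - t / w * (w * normalized_moment \<tau> k i m)"
proof (cases "w = 0")
  case True
  have "\<tau> j = \<tau> i" if "j \<in> {i..i + int k + 1}" for j
    using that True monotone_onD[OF assms(1), of i j] monotone_onD[OF assms(1), of j "i + int k + 1"]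
    by (auto simp: w_def)
  then have const: "\<tau> j = t" if "j \<in> {i..i + int k + 1}" for j
    using assms(2) that by (metis imageE)
  \<comment> \<open>At coincident knots the moments form a geometric sequence in m with ratio t, so
    the left-hand difference is zero.\<close>
  have "normalized_moment \<tau> k i m = t ^ m / (real k + 1)" for m
  proof -
    have "complete_hom \<tau> i (Suc k) m = real ((Suc k + m) choose m) * t ^ m"
      by (rule complete_hom_const) (rule const, simp)
    also have "real ((Suc k + m) choose m) = fact (m + k + 1) / (fact m * fact (Suc k))"
      by (subst binomial_fact) (auto simp: add_ac)
    finally have "normalized_moment \<tau> k i m =
        fact k * fact m / fact (m + k + 1) *
        (fact (m + k + 1) / (fact m * ((real k + 1) * fact k)) * t ^ m)"
      by (simp only: normalized_moment_def fact_Suc of_nat_Suc of_nat_mult add.commute)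
    also have "\<dots> = t ^ m / (real k + 1)"
      using fact_nonzero[of "m + k + 1", where 'a = real] by (simp del: fact_Suc add_Suc_right)
    finally show ?thesis .
  qed
  then show ?thesis using True by simp
qed simp

text \<open>The right-hand side is what the Cox--de Boor weights \<open>x - \<tau> i\<close> and
  \<open>\<tau> (i + k + 2) - x\<close> produce under the integral. Its parts of degree m + 1 and of
  degree m reduce to the same multiple \<open>?D\<close> of the longer polynomial, and the factorial
  factors subtract to the one for degree k + 1.\<close>

lemma normalized_moment_Suc:
  "(\<tau> (i + int k + 2) - \<tau> i) * normalized_moment \<tau> (Suc k) i m =
     (normalized_moment \<tau> k i (Suc m) - \<tau> i * normalized_moment \<tau> k i m) -
     (normalized_moment \<tau> k (i + 1) (Suc m) - \<tau> (i + int k + 2) * normalized_moment \<tau> k (i + 1) m)"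
proof -
  let ?c = "\<lambda>m. fact k * fact m / fact (m + k + 1) :: real"
  let ?L = "complete_hom \<tau> i (Suc k)" and ?R = "complete_hom \<tau> (i + 1) (Suc k)"
  let ?D = "(\<tau> (i + int k + 2) - \<tau> i) * complete_hom \<tau> i (Suc (Suc k)) m"
  have 1: "?R (Suc m) - ?L (Suc m) = ?D"
    using complete_hom_difference[of \<tau> i "Suc k" m] by (simp add: add_ac del: complete_hom.simps)
  have 2: "\<tau> (i + int k + 2) * ?R m - \<tau> i * ?L m = ?D"
    using complete_hom_ends[of \<tau> i "Suc k" m] by (simp add: add_ac del: complete_hom.simps)
  have "(normalized_moment \<tau> k i (Suc m) - \<tau> i * normalized_moment \<tau> k i m) -
     (normalized_moment \<tau> k (i + 1) (Suc m) - \<tau> (i + int k + 2) * normalized_moment \<tau> k (i + 1) m)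
     = ?c m * (\<tau> (i + int k + 2) * ?R m - \<tau> i * ?L m) - ?c (Suc m) * (?R (Suc m) - ?L (Suc m))"
    unfolding normalized_moment_def by (simp only: algebra_simps)
  also have "\<dots> = (?c m - ?c (Suc m)) * ?D"
    unfolding 1 2 by (simp only: left_diff_distrib)
  also have "?c m - ?c (Suc m) = fact (Suc k) * fact m / fact (m + Suc k + 1)"
    by (simp add: divide_simps) (simp add: algebra_simps)
  finally show ?thesis
    unfolding normalized_moment_def by (simp only: mult_ac)
qed

section \<open>Moments of B-splines\<close>

lemma borel_measurable_bspline [measurable]: "bspline \<tau> b k i \<in> borel_measurable borel"
proof (induction k arbitrary: i)
  case 0
  show ?case by simp
next
  case (Suc k)
  note [measurable] = Suc
  show ?case by simp
qed

text \<open>Induction on the degree with m arbitrary, since the weights of the recursion raise the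
  power of x. The hypotheses concern only the knots of one B-spline and thus pass to both B-splines
  of lower degree.\<close>

lemma has_bochner_integral_power_bspline:
  assumes "mono_on {i..i + int k + 1} \<tau>" and "a \<le> \<tau> i" and "\<tau> (i + int k + 1) \<le> b"
  shows "has_bochner_integral lborel (\<lambda>x. indicator {a..b} x * (x ^ m * bspline \<tau> b k i x))
           ((\<tau> (i + int k + 1) - \<tau> i) * normalized_moment \<tau> k i m)"
  using assms
proof (induction k arbitrary: i m)
  case 0
  have le: "\<tau> i \<le> \<tau> (i + 1)"
    using 0 monotone_onD[OF "0.prems"(1), of i "i + 1"] by auto
  have "has_bochner_integral lborel (\<lambda>x. x ^ m * indicator {\<tau> i..\<tau> (i + 1)} x)
      (\<tau> (i + 1) ^ Suc m / Suc m - \<tau> i ^ Suc m / Suc m)"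
  proof (rule has_bochner_integral_FTC_Icc_real[OF le])
    fix x
    have "((\<lambda>x. x ^ Suc m / Suc m) has_real_derivative real (Suc m) * x ^ m / Suc m) (at x)"
      using DERIV_pow[of "Suc m" x] by (intro DERIV_cdivide) simp
    then show "((\<lambda>x. x ^ Suc m / Suc m) has_real_derivative x ^ m) (at x)"
      by simp
  qed (auto intro!: continuous_intros)
  also have "(\<tau> (i + 1) ^ Suc m / Suc m - \<tau> i ^ Suc m / Suc m) =
      (\<tau> (i + int 0 + 1) - \<tau> i) * normalized_moment \<tau> 0 i m"
  proof -
    have "normalized_moment \<tau> 0 i m = complete_hom \<tau> i (Suc 0) m / Suc m"
      by (simp add: normalized_moment_def del: complete_hom.simps of_nat_Suc)
    then show ?thesis
      using complete_hom_difference[of \<tau> i 0 m]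
      by (simp add: diff_divide_distrib del: complete_hom.simps(2,3) of_nat_Suc)
  qed
  finally have I: "has_bochner_integral lborel (\<lambda>x. x ^ m * indicator {\<tau> i..\<tau> (i + 1)} x)
      ((\<tau> (i + int 0 + 1) - \<tau> i) * normalized_moment \<tau> 0 i m)" .
  \<comment> \<open>The half-open interval and the exceptional value at \<open>b\<close> change the
    integrand only on a finite set.\<close>
  have "AE x in lborel. x \<notin> {\<tau> i, \<tau> (i + 1), b}"
    by (intro AE_I'[of "{\<tau> i, \<tau> (i + 1), b}"] finite_imp_null_set_lborel) auto
  then have "AE x in lborel. indicator {a..b} x * (x ^ m * bspline \<tau> b 0 i x) =
      x ^ m * indicator {\<tau> i..\<tau> (i + 1)} x"
    by eventually_elim (use 0 le in \<open>auto simp: indicator_def\<close>)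
  then show ?case
    using I by (subst has_bochner_integral_cong_AE) auto
next
  case (Suc k)
  define w1 w2 where "w1 = \<tau> (i + int k + 1) - \<tau> i" and "w2 = \<tau> (i + int k + 2) - \<tau> (i + 1)"
  let ?T = "\<tau> (i + int k + 2)"
  define M where "M = normalized_moment \<tau> k"
  let ?B = "\<lambda>m i x. indicator {a..b} x * (x ^ m * bspline \<tau> b k i x)"
  note mono = monotone_onD[OF Suc.prems(1)]
  have mono1: "mono_on {i..i + int k + 1} \<tau>" and mono2: "mono_on {i + 1..i + 1 + int k + 1} \<tau>"
    by (rule mono_on_subset[OF Suc.prems(1)]; simp; fail)+
  have end_le: "?T \<le> b" using Suc.prems(3) by (simp add: add_ac)
  have bounds: "\<tau> (i + int k + 1) \<le> b" "a \<le> \<tau> (i + 1)"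
    using Suc.prems(2) end_le mono[of "i + int k + 1" "i + int k + 2"] mono[of i "i + 1"] by auto
  have L: "has_bochner_integral lborel (?B m i) (w1 * M i m)" for m
    unfolding w1_def M_def by (rule Suc.IH[OF mono1 Suc.prems(2) bounds(1)])
  have R: "has_bochner_integral lborel (?B m (i + 1)) (w2 * M (i + 1) m)" for m
    using Suc.IH[OF mono2 bounds(2), of m] end_le by (simp add: w2_def M_def add_ac)
  \<comment> \<open>The recursion times \<open>x ^ m\<close>, sorted by powers of x. The second
    weight is written as minus \<open>(x - ?T) / w2\<close>, so that
    \<open>normalized_moment_cancel\<close> fits both pairs, with the knots \<open>\<tau> i\<close>
    and \<open>?T\<close>.\<close>
  have "has_bochner_integral lborel
      (\<lambda>x. (1 / w1 * ?B (Suc m) i x - \<tau> i / w1 * ?B m i x) -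
           (1 / w2 * ?B (Suc m) (i + 1) x - ?T / w2 * ?B m (i + 1) x))
      ((1 / w1 * (w1 * M i (Suc m)) - \<tau> i / w1 * (w1 * M i m)) -
       (1 / w2 * (w2 * M (i + 1) (Suc m)) - ?T / w2 * (w2 * M (i + 1) m)))"
    by (intro has_bochner_integral_diff has_bochner_integral_mult_right L R)
  also have "1 / w1 * (w1 * M i (Suc m)) - \<tau> i / w1 * (w1 * M i m) = M i (Suc m) - \<tau> i * M i m"
    unfolding w1_def M_def by (rule normalized_moment_cancel[symmetric, OF mono1]) auto
  also have "1 / w2 * (w2 * M (i + 1) (Suc m)) - ?T / w2 * (w2 * M (i + 1) m) =
      M (i + 1) (Suc m) - ?T * M (i + 1) m"
    using normalized_moment_cancel[symmetric, OF mono2, of ?T m]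
    by (simp add: w2_def M_def add_ac)
  also have "M i (Suc m) - \<tau> i * M i m - (M (i + 1) (Suc m) - ?T * M (i + 1) m) =
      (\<tau> (i + int (Suc k) + 1) - \<tau> i) * normalized_moment \<tau> (Suc k) i m"
    using normalized_moment_Suc[of \<tau> i k m] by (simp add: M_def add_ac)
  \<comment> \<open>With division as multiplication by an inverse this is a ring identity, valid
    also if \<open>w1\<close> or \<open>w2\<close> is zero.\<close>
  also have "(\<lambda>x. (1 / w1 * ?B (Suc m) i x - \<tau> i / w1 * ?B m i x) -
           (1 / w2 * ?B (Suc m) (i + 1) x - ?T / w2 * ?B m (i + 1) x)) =
      (\<lambda>x. indicator {a..b} x * (x ^ m * bspline \<tau> b (Suc k) i x))"
    unfolding bspline.simps w1_def[symmetric] w2_def[symmetric] divide_inverse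
    by (rule ext) (simp add: algebra_simps)
  finally show ?case .
qed

section \<open>Integrals of B-splines on extended knots\<close>

text \<open>The additional knots repeat the end knots, so \<open>\<tau>\<close> factors through the
  monotone clamping of indices to \<open>{0..g + 1}\<close>.\<close>

lemma extended_knots_mono:
  assumes "extended_knots k g a b \<tau>"
  shows "mono_on {- int k..int g + int k + 1} \<tau>"
proof (rule mono_onI)
  fix i j
  assume ij: "i \<in> {- int k..int g + int k + 1}" "j \<in> {- int k..int g + int k + 1}" "i \<le> j"
  let ?clamp = "\<lambda>r. max 0 (min (int g + 1) r)"
  have clamp: "\<tau> r = \<tau> (?clamp r)" if "r \<in> {- int k..int g + int k + 1}" for r
  proof -
    consider "r \<in> {- int k..-1}" | "r \<in> {0..int g + 1}" | "r \<in> {int g + 2..int g + int k + 1}"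
      using \<open>r \<in> {- int k..int g + int k + 1}\<close> by fastforce
    then show ?thesis
      using assms by cases (auto simp: extended_knots_def min_def max_def)
  qed
  have "strict_mono_on {0..int g + 1} \<tau>"
    using assms by (simp add: extended_knots_def)
  then have "mono_on {0..int g + 1} \<tau>"
    by (rule strict_mono_on_imp_mono_on)
  then have "\<tau> (?clamp i) \<le> \<tau> (?clamp j)"
    by (rule monotone_onD) (use ij in auto)
  then show "\<tau> i \<le> \<tau> j"
    using clamp ij by simp
qed

lemma has_bochner_integral_bspline:
  assumes "extended_knots k g a b \<tau>" and "i \<in> {- int k..int g}"
  shows "has_bochner_integral lborel (\<lambda>x. indicator {a..b} x * bspline \<tau> b k i x)
           ((\<tau> (i + int k + 1) - \<tau> i) / (real k + 1))"
proof -
  note mono = extended_knots_mono[OF assms(1)]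
  \<comment> \<open>For k = 0 there are no additional knots, and the outermost indices are 0 and g +
    1 themselves.\<close>
  have ends: "\<tau> (- int k) = a" "\<tau> (int g + int k + 1) = b"
    using assms(1) by (cases "k = 0"; auto simp: extended_knots_def)+
  have "has_bochner_integral lborel (\<lambda>x. indicator {a..b} x * (x ^ 0 * bspline \<tau> b k i x))
          ((\<tau> (i + int k + 1) - \<tau> i) * normalized_moment \<tau> k i 0)"
  proof (rule has_bochner_integral_power_bspline)
    show "mono_on {i..i + int k + 1} \<tau>"
      by (rule mono_on_subset[OF mono]) (use assms(2) in auto)
    show "a \<le> \<tau> i" "\<tau> (i + int k + 1) \<le> b"
      using assms(2) monotone_onD[OF mono, of "- int k" i]
        monotone_onD[OF mono, of "i + int k + 1" "int g + int k + 1"] ends by auto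
  qed
  also have "normalized_moment \<tau> k i 0 = 1 / (real k + 1)"
    by (simp add: normalized_moment_def del: of_nat_Suc)
  finally show ?thesis by simp
qed

section \<open>From Lebesgue to gauge integrals, and products of functions\<close>

lemma has_bochner_integral_imp_has_integral:
  fixes f :: "'a::euclidean_space \<Rightarrow> real"
  assumes "has_bochner_integral lborel (\<lambda>x. indicator S x * f x) I"
  shows "(f has_integral I) S"
proof -
  have "((\<lambda>x. indicator S x * f x) has_integral I) UNIV"
    using assms has_integral_integral_lborel by (force simp: has_bochner_integral_iff)
  also have "(\<lambda>x. indicator S x * f x) = (\<lambda>x. if x \<in> S then f x else 0)"
    by auto
  finally show ?thesis by (simp add: has_integral_restrict_UNIV)
qed

lemma has_bochner_integral_lborel_product:
  fixes f :: "'a::euclidean_space \<Rightarrow> real" and g :: "'b::euclidean_space \<Rightarrow> real"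
  assumes "has_bochner_integral lborel f I" and "has_bochner_integral lborel g J"
  shows "has_bochner_integral lborel (\<lambda>z. f (fst z) * g (snd z)) (I * J)"
proof -
  have f: "integrable lborel f" "integral\<^sup>L lborel f = I"
    and g: "integrable lborel g" "integral\<^sup>L lborel g = J"
    using assms by (auto simp: has_bochner_integral_iff)
  have [measurable]: "f \<in> borel_measurable borel" "g \<in> borel_measurable borel"
    using borel_measurable_integrable[OF f(1)] borel_measurable_integrable[OF g(1)] by auto
  have fg: "integrable (lborel \<Otimes>\<^sub>M lborel) (\<lambda>z. f (fst z) * g (snd z))"
  proof (rule lborel_pair.Fubini_integrable)
    \<comment> \<open>The inner integral is \<open>\<bar>f x\<bar>\<close> times a constant, the
      integral of \<open>\<bar>g y\<bar>\<close>.\<close>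
    show "integrable lborel (\<lambda>x. \<integral>y. norm (f (fst (x, y)) * g (snd (x, y))) \<partial>lborel)"
      using f(1) by (simp add: abs_mult)
  qed (use g(1) in auto)
  have "integral\<^sup>L (lborel \<Otimes>\<^sub>M lborel) (\<lambda>z. f (fst z) * g (snd z)) = I * J"
    using lborel_pair.integral_fst'[OF fg] f(2) g(2) by simp
  with fg show ?thesis by (simp add: has_bochner_integral_iff lborel_prod)
qed

section \<open>Term-by-term integration of the tensor product spline\<close>

theorem theorem5p3:
  fixes k l g h :: nat
    and a b c d :: real
    and \<Lambda> \<mu> :: "int \<Rightarrow> real"
    and s :: "real \<times> real \<Rightarrow> real"
    and s\<^sub>k s\<^sub>l :: "real \<Rightarrow> real"
    and \<beta> :: "int \<Rightarrow> int \<Rightarrow> real"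
    and t \<delta> v u :: "int \<Rightarrow> real"
  assumes "k > 0" and "l > 0"
    and "extended_knots k g a b \<Lambda>"
    and "extended_knots l h c d \<mu>"
    and "s \<in> tensor_spline_space k g a b \<Lambda> l h c d \<mu>"
    and "\<And>x y. x \<in> {a..b} \<Longrightarrow> y \<in> {c..d} \<Longrightarrow> s (x, y) =
           (\<Sum>i = - int k..int g. \<Sum>j = - int l..int h.
              \<beta> i j * bspline \<Lambda> b k i x * bspline \<mu> d l j y)"
    and "integral ({a..b} \<times> {c..d}) s = 0"
    and "\<And>x. x \<in> {a..b} \<Longrightarrow> s\<^sub>k x = integral {c..d} (\<lambda>y. s (x, y))"
    and "\<And>y. y \<in> {c..d} \<Longrightarrow> s\<^sub>l y = integral {a..b} (\<lambda>x. s (x, y))"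
    and "\<And>j. j \<in> {- int l..int h} \<Longrightarrow> t j = (real l + 1) / (\<mu> (j + int l + 1) - \<mu> j)"
    and "\<And>i. i \<in> {- int k..int g} \<Longrightarrow> \<delta> i = (real k + 1) / (\<Lambda> (i + int k + 1) - \<Lambda> i)"
    and "\<And>i. i \<in> {- int k..int g} \<Longrightarrow> v i = (\<Sum>j = - int l..int h. \<beta> i j / t j)"
    and "\<And>j. j \<in> {- int l..int h} \<Longrightarrow> u j = (\<Sum>i = - int k..int g. \<beta> i j / \<delta> i)"
  shows "s\<^sub>k \<in> spline_space k g a b \<Lambda> \<and> s\<^sub>l \<in> spline_space l h c d \<mu> \<and>
    (\<forall>x\<in>{a..b}. s\<^sub>k x = (\<Sum>i = - int k..int g. v i * bspline \<Lambda> b k i x)) \<and>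
    (\<forall>y\<in>{c..d}. s\<^sub>l y = (\<Sum>j = - int l..int h. u j * bspline \<mu> d l j y)) \<and>
    (s\<^sub>k has_integral 0) {a..b} \<and> (s\<^sub>l has_integral 0) {c..d}"
proof -
  let ?K = "{- int k..int g}" and ?L = "{- int l..int h}"
  let ?B = "bspline \<Lambda> b k" and ?C = "bspline \<mu> d l"
  note knots = assms(3,4) and s = assms(6)
  have B: "has_bochner_integral lborel (\<lambda>x. indicator {a..b} x * ?B i x) (1 / \<delta> i)" if "i \<in> ?K" for i
    using has_bochner_integral_bspline[OF knots(1) that] assms(11)[OF that] by simp
  have C: "has_bochner_integral lborel (\<lambda>y. indicator {c..d} y * ?C j y) (1 / t j)" if "j \<in> ?L" for j
    using has_bochner_integral_bspline[OF knots(2) that] assms(10)[OF that] by simp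
  note B' = has_bochner_integral_imp_has_integral[OF B]
    and C' = has_bochner_integral_imp_has_integral[OF C]
  \<comment> \<open>Integration over y replaces each \<open>?C j y\<close> by
    \<open>1 / t j\<close>; the sum over j then collects into \<open>v i\<close>.\<close>
  have sk: "s\<^sub>k x = (\<Sum>i\<in>?K. v i * ?B i x)" if x: "x \<in> {a..b}" for x
  proof -
    have "((\<lambda>y. \<Sum>i\<in>?K. \<Sum>j\<in>?L. \<beta> i j * ?B i x * ?C j y) has_integral
        (\<Sum>i\<in>?K. \<Sum>j\<in>?L. \<beta> i j * ?B i x * (1 / t j))) {c..d}"
      by (intro has_integral_sum has_integral_mult_right C') auto
    then have "((\<lambda>y. s (x, y)) has_integral
        (\<Sum>i\<in>?K. \<Sum>j\<in>?L. \<beta> i j * ?B i x * (1 / t j))) {c..d}"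
      by (rule has_integral_eq[rotated]) (use s x in auto)
    then have "s\<^sub>k x = (\<Sum>i\<in>?K. \<Sum>j\<in>?L. \<beta> i j * ?B i x * (1 / t j))"
      using assms(8)[OF x] by (simp add: integral_unique)
    also have "\<dots> = (\<Sum>i\<in>?K. v i * ?B i x)"
      by (intro sum.cong refl) (simp add: assms(12) sum_distrib_right)
    finally show ?thesis .
  qed
  have sl: "s\<^sub>l y = (\<Sum>j\<in>?L. u j * ?C j y)" if y: "y \<in> {c..d}" for y
  proof -
    have "((\<lambda>x. \<Sum>i\<in>?K. \<Sum>j\<in>?L. \<beta> i j * ?B i x * ?C j y) has_integral
        (\<Sum>i\<in>?K. \<Sum>j\<in>?L. \<beta> i j * (1 / \<delta> i) * ?C j y)) {a..b}"
      by (intro has_integral_sum has_integral_mult_right has_integral_mult_left B') auto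
    then have "((\<lambda>x. s (x, y)) has_integral
        (\<Sum>i\<in>?K. \<Sum>j\<in>?L. \<beta> i j * (1 / \<delta> i) * ?C j y)) {a..b}"
      by (rule has_integral_eq[rotated]) (use s y in auto)
    then have "s\<^sub>l y = (\<Sum>i\<in>?K. \<Sum>j\<in>?L. \<beta> i j * (1 / \<delta> i) * ?C j y)"
      using assms(9)[OF y] by (simp add: integral_unique)
    \<comment> \<open>\<open>u j\<close> sums over i, which is the outer index here.\<close>
    also have "\<dots> = (\<Sum>j\<in>?L. \<Sum>i\<in>?K. \<beta> i j * (1 / \<delta> i) * ?C j y)"
      by (rule sum.swap)
    also have "\<dots> = (\<Sum>j\<in>?L. u j * ?C j y)"
      by (intro sum.cong refl) (simp add: assms(13) sum_distrib_right)
    finally show ?thesis .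
  qed
  have BC: "((\<lambda>z. ?B i (fst z) * ?C j (snd z)) has_integral 1 / \<delta> i * (1 / t j)) ({a..b} \<times> {c..d})"
    if "i \<in> ?K" "j \<in> ?L" for i j
  proof (rule has_bochner_integral_imp_has_integral)
    show "has_bochner_integral lborel
        (\<lambda>z. indicator ({a..b} \<times> {c..d}) z * (?B i (fst z) * ?C j (snd z))) (1 / \<delta> i * (1 / t j))"
      using has_bochner_integral_lborel_product[OF B[OF that(1)] C[OF that(2)]]
      by (simp add: indicator_times mult_ac)
  qed
  have "((\<lambda>z. \<Sum>i\<in>?K. \<Sum>j\<in>?L. \<beta> i j * (?B i (fst z) * ?C j (snd z))) has_integral
      (\<Sum>i\<in>?K. \<Sum>j\<in>?L. \<beta> i j * (1 / \<delta> i * (1 / t j)))) ({a..b} \<times> {c..d})"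
    by (intro has_integral_sum has_integral_mult_right BC) auto
  \<comment> \<open>\<open>integral\<close> defaults to 0 on non-integrable functions, so
    integrability of \<open>s\<close> is established before the hypothesis is used. The hypothesis
    then becomes an equation for the coefficients.\<close>
  then have "(s has_integral (\<Sum>i\<in>?K. \<Sum>j\<in>?L. \<beta> i j * (1 / \<delta> i * (1 / t j)))) ({a..b} \<times> {c..d})"
    by (rule has_integral_eq[rotated]) (auto simp: s mult_ac)
  then have total: "(\<Sum>i\<in>?K. \<Sum>j\<in>?L. \<beta> i j * (1 / \<delta> i * (1 / t j))) = 0"
    using assms(7) by (simp add: integral_unique)
  have "((\<lambda>x. \<Sum>i\<in>?K. v i * ?B i x) has_integral (\<Sum>i\<in>?K. v i * (1 / \<delta> i))) {a..b}"
    by (intro has_integral_sum has_integral_mult_right B') auto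
  \<comment> \<open>Inserting \<open>v i\<close> gives exactly the double sum in
    \<open>total\<close>; the same holds for \<open>u j\<close> below after exchanging the
    sums.\<close>
  moreover have "(\<Sum>i\<in>?K. v i * (1 / \<delta> i)) = 0"
    unfolding total[symmetric]
    by (intro sum.cong refl) (simp add: assms(12) sum_divide_distrib mult_ac)
  ultimately have sk0: "(s\<^sub>k has_integral 0) {a..b}"
    by (intro has_integral_eq[of _ _ s\<^sub>k]) (auto simp: sk)
  have "((\<lambda>y. \<Sum>j\<in>?L. u j * ?C j y) has_integral (\<Sum>j\<in>?L. u j * (1 / t j))) {c..d}"
    by (intro has_integral_sum has_integral_mult_right C') auto
  moreover have "(\<Sum>j\<in>?L. u j * (1 / t j)) = 0"
    unfolding total[symmetric] sum.swap[of _ ?L ?K]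
    by (intro sum.cong refl) (simp add: assms(13) sum_divide_distrib mult_ac)
  ultimately have sl0: "(s\<^sub>l has_integral 0) {c..d}"
    by (intro has_integral_eq[of _ _ s\<^sub>l]) (auto simp: sl)
  show ?thesis
    using sk sl sk0 sl0 unfolding spline_space_def by blast
qed

end
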